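(* Let $n \ge 10$ be an integer, let $\delta \in [0,0.4]$, and let $x^0 \in \mathbb{R}^n$. Let $x^{\ell n}$, $\ell = 0,1,2,\dots$, be the iterates at the ends of the epochs of RPCD with exact line search, started from $x^0$, for minimizing $f(x) = \frac12 x^T A x$ with $A = \delta I + (1-\delta)\mathbf{1}\mathbf{1}^T$, and let $(\eta_\ell,\nu_\ell) \in \mathbb{R}^2$, $\ell \ge 0$, be the sequence defined in the context. Then \[ |\eta_\ell| \le (1-2\delta+4\delta^2)^{\ell-1}\,\delta, \qquad |\nu_\ell| \le (1-2\delta+4\delta^2)^{\ell-1}\,\delta, \qquad \text{for all } \ell \ge 1 . \] Consequently, \[ \mathbb{E}_{P_1,P_2,\dots,P_\ell}\, f(x^{\ell n}) \le \frac12 (1-2\delta+4\delta^2)^{\ell-1}\left( \|x^0\|^2 + (\mathbf{1}^T x^0)^2 \right)\delta, \qquad \text{for all } \ell \ge 1 . \]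
   Context: $\mathbf{1} = (1,1,\dots,1)^T \in \mathbb{R}^n$, $\|\cdot\|$ is the Euclidean norm, $\|\cdot\|_F$ the Frobenius norm. The matrix $A = \delta I + (1-\delta)\mathbf{1}\mathbf{1}^T \in \mathbb{R}^{n\times n}$ has unit diagonal and satisfies $P^TAP = A$ for every permutation matrix $P$. RPCD (random-permutations cyclic coordinate descent) with exact line search: at the start of each epoch $\ell = 0,1,2,\dots$ a permutation $\pi_{\ell+1}$ of $\{1,\dots,n\}$ is drawn uniformly at random, independently of the previous ones. Epoch $\ell$ consists of the $n$ iterations $k = \ell n + j$, $j=0,\dots,n-1$, where, with $i$ the $(j+1)$th entry of $\pi_{\ell+1}$, \[ x^{k+1} = x^k - (Ax^k)_i\, e_i , \] $e_i$ being the $i$th standard basis vector (this is exact minimization of $f$ along coordinate $i$, as $A_{ii}=1$). Thus $x^{\ell n}$ is the iterate after $\ell$ epochs. Write $P_l$ for the permutation matrix representing $\pi_l$. Then \[ x^{\ell n} = P_\ell C P_\ell^T\, P_{\ell-1} C P_{\ell-1}^T \cdots P_1 C P_1^T\, x^0, \] where $C = -(L+D)^{-1}L^T$ and $A = L + D + L^T$ with $L$ strictly lower triangular and $D = I$ the diagonal of $A$. The expectation is over the independent uniformly random $P_1,\dots,P_\ell$. Define \[ d_2 = \frac{\|C\mathbf{1}\|^2 - \|C\|_F^2}{n(n-1)},\quad d_1 = \frac{\|C\|_F^2}{n} - d_2,\quad m_2 = \frac{(\mathbf{1}^TC\mathbf{1})^2 - \|C^T\mathbf{1}\|^2}{n(n-1)},\quad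 m_1 = \frac{\|C^T\mathbf{1}\|^2}{n} - m_2, \] \[ M = \begin{pmatrix} d_1 & m_1 \\ d_2 & m_2 \end{pmatrix}, \qquad \begin{pmatrix}\eta_\ell \\ \nu_\ell\end{pmatrix} = M^\ell \begin{pmatrix} \delta \\ 1-\delta\end{pmatrix},\quad \ell \ge 0 . \] *)

theory Defs
  imports "HOL-Probability.Probability"
    "Jordan_Normal_Form.Matrix"
    "Jordan_Normal_Form.Gauss_Jordan_Elimination"
begin

(* The dimension is a natural number, so vectors and matrices are those of Jordan_Normal_Form;
   the type-indexed vectors of HOL-Analysis are hidden. *)
hide_type (open) Finite_Cartesian_Product.vec
hide_const (open) Finite_Cartesian_Product.vec Finite_Cartesian_Product.row
  Finite_Cartesian_Product.mat Finite_Cartesian_Product.transpose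
unbundle no vec_syntax
unbundle no inner_syntax

definition ones_vec :: "nat \<Rightarrow> real vec" where
  "ones_vec n = vec n (\<lambda>_. 1)"

definition vec_norm2 :: "real vec \<Rightarrow> real" where
  "vec_norm2 v = L2_set (\<lambda>i. v $ i) {..<dim_vec v}"

definition frob_norm :: "real mat \<Rightarrow> real" where
  "frob_norm B = L2_set (\<lambda>ij. B $$ ij) ({..<dim_row B} \<times> {..<dim_col B})"

definition A_mat :: "nat \<Rightarrow> real \<Rightarrow> real mat" where
  "A_mat n \<delta> = \<delta> \<cdot>\<^sub>m 1\<^sub>m n
     + (1 - \<delta>) \<cdot>\<^sub>m (mat_of_cols n [ones_vec n] * mat_of_rows n [ones_vec n])"

definition quad_obj :: "real mat \<Rightarrow> real vec \<Rightarrow> real" where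
  "quad_obj A x = 1/2 * (x \<bullet> (A *\<^sub>v x))"

(* The iterate after k single-coordinate steps. Coordinates are 0-based and epochs are
   numbered from 0, so step k is step k mod n of epoch k div n, which uses the permutation
   \<pi> (k div n + 1); the entry \<pi> l j is the coordinate visited in position j.
   The unit step length is exact line search only when A has unit diagonal. *)
primrec cd_iter :: "nat \<Rightarrow> real mat \<Rightarrow> (nat \<Rightarrow> nat \<Rightarrow> nat) \<Rightarrow> real vec \<Rightarrow> nat \<Rightarrow> real vec" where
  "cd_iter n A \<pi> x0 0 = x0"
| "cd_iter n A \<pi> x0 (Suc k) =
     (let x = cd_iter n A \<pi> x0 k; i = \<pi> (k div n + 1) (k mod n)
      in x - ((A *\<^sub>v x) $ i) \<cdot>\<^sub>v unit_vec n i)"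

definition strict_lower :: "real mat \<Rightarrow> real mat" where
  "strict_lower A = mat (dim_row A) (dim_col A) (\<lambda>(i, j). if j < i then A $$ (i, j) else 0)"

definition diag_part :: "real mat \<Rightarrow> real mat" where
  "diag_part A = mat (dim_row A) (dim_col A) (\<lambda>(i, j). if i = j then A $$ (i, j) else 0)"

(* The inverse exists as soon as A is square without zeros on the diagonal. *)
definition C_mat :: "real mat \<Rightarrow> real mat" where
  "C_mat A = - (the (mat_inverse (strict_lower A + diag_part A)) * transpose_mat (strict_lower A))"

definition coef_d2 :: "nat \<Rightarrow> real mat \<Rightarrow> real" where
  "coef_d2 n C = ((vec_norm2 (C *\<^sub>v ones_vec n))\<^sup>2 - (frob_norm C)\<^sup>2) / (real n * (real n - 1))"

definition coef_d1 :: "nat \<Rightarrow> real mat \<Rightarrow> real" where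
  "coef_d1 n C = (frob_norm C)\<^sup>2 / real n - coef_d2 n C"

definition coef_m2 :: "nat \<Rightarrow> real mat \<Rightarrow> real" where
  "coef_m2 n C = ((ones_vec n \<bullet> (C *\<^sub>v ones_vec n))\<^sup>2
     - (vec_norm2 (transpose_mat C *\<^sub>v ones_vec n))\<^sup>2) / (real n * (real n - 1))"

definition coef_m1 :: "nat \<Rightarrow> real mat \<Rightarrow> real" where
  "coef_m1 n C = (vec_norm2 (transpose_mat C *\<^sub>v ones_vec n))\<^sup>2 / real n - coef_m2 n C"

definition M_mat :: "nat \<Rightarrow> real \<Rightarrow> real mat" where
  "M_mat n \<delta> = (let C = C_mat (A_mat n \<delta>) in
     mat_of_rows_list 2 [[coef_d1 n C, coef_m1 n C], [coef_d2 n C, coef_m2 n C]])"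

definition eta_nu :: "nat \<Rightarrow> real \<Rightarrow> nat \<Rightarrow> real vec" where
  "eta_nu n \<delta> l = (M_mat n \<delta> ^\<^sub>m l) *\<^sub>v vec_of_list [\<delta>, 1 - \<delta>]"

definition eta :: "nat \<Rightarrow> real \<Rightarrow> nat \<Rightarrow> real" where
  "eta n \<delta> l = eta_nu n \<delta> l $ 0"

definition nu :: "nat \<Rightarrow> real \<Rightarrow> nat \<Rightarrow> real" where
  "nu n \<delta> l = eta_nu n \<delta> l $ 1"

(* \<pi> 1, \<pi> 2, \<dots> are independent and uniformly distributed over the permutations of {..<n}. *)
definition iid_uniform_perms :: "nat \<Rightarrow> 'w measure \<Rightarrow> (nat \<Rightarrow> 'w \<Rightarrow> nat \<Rightarrow> nat) \<Rightarrow> bool" where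
  "iid_uniform_perms n \<Omega> \<pi> \<longleftrightarrow>
     prob_space.indep_vars \<Omega> (\<lambda>_. count_space {p. p permutes {..<n}}) \<pi> {1..} \<and>
     (\<forall>l\<ge>1. distr \<Omega> (count_space {p. p permutes {..<n}}) (\<pi> l)
             = uniform_count_measure {p. p permutes {..<n}})"

end

theory Submission
  imports Defs "Jordan_Normal_Form.Determinant"
begin

text \<open>
Forward substitution gives the entries of $C$ in closed form, so that the row and column sums and
the norms entering $d_1, d_2, m_1, m_2$ reduce to geometric sums. They satisfy
$0 \le d_1, d_2 \le (1-\delta)/(1+\delta)$ and $0 \le m_1, m_2 \le \delta^2$. Since
$(1-\delta)/(1+\delta) + \delta^2 \le 1 - 2\delta + 4\delta^2$, the matrix $M$ contracts the maximum
norm by this factor, while $d_i\,\delta + m_i\,(1-\delta) \le \delta$ handles the first step.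

For the expectation, averaging a quadratic form over all simultaneous permutations of the
coordinates leaves a combination $\eta\,\|x\|^2 + \nu\,(\mathbf{1}^T x)^2$ determined by its trace
and its total sum. Taken over the last epoch, which is independent of the earlier ones, this average
multiplies $(\eta, \nu)$ by $M$, and induction on the number of epochs applies.
\<close>

section \<open>The epoch matrix\<close>

text \<open>This is the entry of \<open>C\<close> in row \<open>i\<close> and column
  \<open>j\<close>, counted from 0, found by solving \<open>(L + D) C = -L^T\<close> row by row.
  Column 0 vanishes, as does column 0 of \<open>L^T\<close>.\<close>

definition sweep_coeff :: "real \<Rightarrow> nat \<Rightarrow> nat \<Rightarrow> real" where
  "sweep_coeff \<delta> i j = (1 - \<delta>) * ((if j \<le> i then \<delta> ^ (i - j) else 0) - \<delta> ^ i)"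

text \<open>Adding one row at a time makes the powers of \<delta> telescope. Every prefix is
  covered, because forward substitution uses prefix sums; the full column sum is the case
  \<open>i = n\<close>.\<close>

lemma sum_sweep_coeff_column:
  "(\<Sum>k<i. sweep_coeff \<delta> k j) = \<delta> ^ i - (if j < i then \<delta> ^ (i - j) else 1)"
proof (induction i)
  case (Suc i)
  consider "j < i" | "j = i" | "j > i" by linarith
  then show ?case
    by cases (use Suc in \<open>simp_all add: sweep_coeff_def Suc_diff_le algebra_simps\<close>)
qed simp

text \<open>This is one entry of \<open>(L + D) C = -L^T\<close>: below the diagonal
  \<open>L\<close> is constantly \<open>1 - \<delta>\<close>, so \<open>L C\<close> only involves
  prefix column sums. It both identifies \<open>C\<close> and describes a single coordinate
  step.\<close>

lemma sweep_coeff_rec: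
  "sweep_coeff \<delta> i j + (1 - \<delta>) * (\<Sum>k<i. sweep_coeff \<delta> k j) = (if i < j then - (1 - \<delta>) else 0)"
  unfolding sum_sweep_coeff_column by (auto simp: sweep_coeff_def algebra_simps)

section \<open>Geometric sums along the rows of \<open>C\<close>\<close>

lemma sum_atMost_diff_power: "(\<Sum>j\<le>i. x ^ (i - j)) = (\<Sum>k\<le>i. (x::real) ^ k)"
  using sum.nat_diff_reindex[of "\<lambda>k. x ^ k" "Suc i"] by (simp add: lessThan_Suc_atMost)

lemma sum_lessThan_if_le:
  fixes i n :: nat
  assumes "i < n"
  shows "(\<Sum>j<n. if j \<le> i then f j else 0) = (\<Sum>j\<le>i. f j :: real)"
proof -
  have "{..<n} \<inter> {j. j \<le> i} = {..i}" using assms by (auto intro: le_less_trans)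
  then show ?thesis by (simp add: sum.If_cases)
qed

lemma geometric_sum: "(1 - x) * (\<Sum>k<n. x ^ k) = 1 - (x::real) ^ n"
  by (simp add: one_diff_power_eq)

lemma geometric_sum_square: "(1 - x\<^sup>2) * (\<Sum>k<n. x ^ (2 * k)) = 1 - (x::real) ^ (2 * n)"
  using geometric_sum[of "x\<^sup>2" n] by (simp add: power_mult)

text \<open>The row sum is affine in \<open>\<delta> ^ i\<close>, so that its square can again be
  summed over the rows by geometric sums.\<close>

lemma sum_sweep_coeff_row:
  assumes "i < n"
  shows "(\<Sum>j<n. sweep_coeff \<delta> i j) = 1 - \<delta> ^ Suc i - real n * (1 - \<delta>) * \<delta> ^ i"
proof -
  have "(\<Sum>j<n. sweep_coeff \<delta> i j)
      = (1 - \<delta>) * ((\<Sum>j\<le>i. \<delta> ^ (i - j)) - real n * \<delta> ^ i)"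
    unfolding sweep_coeff_def sum_distrib_left[symmetric] sum_subtractf sum_lessThan_if_le[OF assms]
    by simp
  also have "\<dots> = (1 - \<delta>) * (\<Sum>k<Suc i. \<delta> ^ k) - real n * (1 - \<delta>) * \<delta> ^ i"
    by (simp only: sum_atMost_diff_power lessThan_Suc_atMost algebra_simps)
  finally show ?thesis unfolding geometric_sum .
qed

text \<open>The factor \<open>1 + \<delta>\<close> turns the prefactor
  \<open>(1 - \<delta>)^2\<close> into a multiple of \<open>1 - \<delta>^2\<close>, which closes the
  geometric sum of ratio \<open>\<delta>^2\<close> without any division.\<close>

lemma sum_sweep_coeff_row_square:
  assumes "i < n"
  shows "(1 + \<delta>) * (\<Sum>j<n. (sweep_coeff \<delta> i j)\<^sup>2)
    = (1 - \<delta>) * (1 - \<delta>\<^sup>2 * \<delta> ^ (2 * i)) - 2 * (1 + \<delta>) * (1 - \<delta>) * (\<delta> ^ i - \<delta> * \<delta> ^ (2 * i))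
      + real n * (1 - \<delta>)\<^sup>2 * (1 + \<delta>) * \<delta> ^ (2 * i)"
proof -
  define E G where "E = (\<Sum>k<Suc i. \<delta> ^ k)" and "G = (\<Sum>k<Suc i. \<delta> ^ (2 * k))"
  have E: "(1 - \<delta>) * E = 1 - \<delta> ^ Suc i" unfolding E_def by (rule geometric_sum)
  have G: "(1 - \<delta>\<^sup>2) * G = 1 - \<delta> ^ (2 * Suc i)" unfolding G_def by (rule geometric_sum_square)
  have sq: "(sweep_coeff \<delta> i j)\<^sup>2 = (1 - \<delta>)\<^sup>2 * ((if j \<le> i then (\<delta>\<^sup>2) ^ (i - j) else 0)
      - 2 * \<delta> ^ i * (if j \<le> i then \<delta> ^ (i - j) else 0) + \<delta> ^ (2 * i))" for j
    by (simp add: sweep_coeff_def power_mult_distrib power2_diff power_mult[symmetric] mult.commute)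
  have "(\<Sum>j<n. (sweep_coeff \<delta> i j)\<^sup>2)
      = (1 - \<delta>)\<^sup>2 * ((\<Sum>j\<le>i. (\<delta>\<^sup>2) ^ (i - j)) - 2 * \<delta> ^ i * (\<Sum>j\<le>i. \<delta> ^ (i - j)) + real n * \<delta> ^ (2 * i))"
    unfolding sq sum_distrib_left[symmetric] sum.distrib sum_subtractf sum_lessThan_if_le[OF assms]
    by simp
  also have "\<dots> = (1 - \<delta>)\<^sup>2 * (G - 2 * \<delta> ^ i * E + real n * \<delta> ^ (2 * i))"
    unfolding sum_atMost_diff_power unfolding lessThan_Suc_atMost[symmetric] E_def G_def by (simp only: power_mult)
  finally have S: "(\<Sum>j<n. (sweep_coeff \<delta> i j)\<^sup>2)
      = (1 - \<delta>)\<^sup>2 * (G - 2 * \<delta> ^ i * E + real n * \<delta> ^ (2 * i))" .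
  \<comment> \<open>The factors are distributed so that exactly the left sides of \<open>G\<close>
    and \<open>E\<close> appear.\<close>
  have "(1 + \<delta>) * (\<Sum>j<n. (sweep_coeff \<delta> i j)\<^sup>2)
      = (1 - \<delta>) * ((1 - \<delta>\<^sup>2) * G) - 2 * (1 + \<delta>) * (1 - \<delta>) * \<delta> ^ i * ((1 - \<delta>) * E)
        + real n * (1 - \<delta>)\<^sup>2 * (1 + \<delta>) * \<delta> ^ (2 * i)"
    unfolding S by (simp add: power2_eq_square algebra_simps)
  moreover have "\<delta> ^ (2 * i) = (\<delta> ^ i)\<^sup>2" "\<delta> ^ (2 * Suc i) = \<delta>\<^sup>2 * (\<delta> ^ i)\<^sup>2" "\<delta> ^ Suc i = \<delta> * \<delta> ^ i"
    by (simp_all add: power_mult[symmetric] power_add[symmetric] mult.commute)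
  ultimately show ?thesis
    unfolding E G by (simp only:) (simp add: power2_eq_square algebra_simps)
qed

section \<open>The matrix \<open>A\<close> and the closed form of its epoch matrix\<close>

lemma A_mat_carrier [simp]: "A_mat n \<delta> \<in> carrier_mat n n"
  unfolding A_mat_def by (intro add_carrier_mat smult_carrier_mat mult_carrier_mat[of _ _ 1]) auto

lemma A_mat_dim [simp]: "dim_row (A_mat n \<delta>) = n" "dim_col (A_mat n \<delta>) = n"
  using A_mat_carrier by blast+

lemma A_mat_index [simp]:
  "i < n \<Longrightarrow> j < n \<Longrightarrow> A_mat n \<delta> $$ (i, j) = (if i = j then 1 else 1 - \<delta>)"
  by (simp add: A_mat_def mat_of_cols_def mat_of_rows_def ones_vec_def scalar_prod_def)

text \<open>\<open>L + D\<close> is unit lower triangular, hence invertible. It therefore suffices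
  that the claimed matrix solves \<open>(L + D) C = -L^T\<close>, which is
  \<open>sweep_coeff_rec\<close> entry by entry.\<close>

lemma C_mat_A_mat: "C_mat (A_mat n \<delta>) = mat n n (\<lambda>(i, j). sweep_coeff \<delta> i j)"
proof -
  let ?T = "strict_lower (A_mat n \<delta>) + diag_part (A_mat n \<delta>)"
  let ?U = "transpose_mat (strict_lower (A_mat n \<delta>))"
  let ?C = "mat n n (\<lambda>(i, j). sweep_coeff \<delta> i j)"
  have T: "?T \<in> carrier_mat n n" by (simp add: strict_lower_def diag_part_def)
  have U: "?U \<in> carrier_mat n n" by (simp add: strict_lower_def)
  have C: "?C \<in> carrier_mat n n" by simp
  have Tij: "?T $$ (i, j) = (if j < i then 1 - \<delta> else if j = i then 1 else 0)" if "i < n" "j < n" for i j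
    using that by (simp add: strict_lower_def diag_part_def)
  have "diag_mat ?T = replicate n 1"
    by (intro nth_equalityI) (auto simp: diag_mat_def strict_lower_def diag_part_def)
  then have "det ?T = 1"
    using det_lower_triangular[OF _ T] by (simp add: Tij prod_list_replicate)
  \<comment> \<open>A nonzero determinant gives a unit of the matrix ring, which excludes
    \<open>None\<close>; the argument \<open>()\<close> selects the same ring in both facts.\<close>
  then obtain B where B: "mat_inverse ?T = Some B"
    using det_non_zero_imp_unit[OF T, of "()"] mat_inverse(1)[OF T, of "()"] by fastforce
  from mat_inverse(2)[OF T B] have BT: "B * ?T = 1\<^sub>m n" and Bc: "B \<in> carrier_mat n n" by auto
  have TC: "?T * ?C = - ?U"
  proof (rule eq_matI)
    fix i j assume "i < dim_row (- ?U)" "j < dim_col (- ?U)"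
    then have ij: "i < n" "j < n" using U by auto
    have "(?T * ?C) $$ (i, j) = (\<Sum>k<n. ?T $$ (i, k) * sweep_coeff \<delta> k j)"
      using ij carrier_matD[OF T] by (simp add: scalar_prod_def atLeast0LessThan del: index_add_mat)
    also have "\<dots> = (\<Sum>k<Suc i. ?T $$ (i, k) * sweep_coeff \<delta> k j)"
      using ij by (intro sum.mono_neutral_right) (auto simp: Tij)
    also have "\<dots> = sweep_coeff \<delta> i j + (1 - \<delta>) * (\<Sum>k<i. sweep_coeff \<delta> k j)"
      using ij by (simp add: Tij sum_distrib_left)
    also have "\<dots> = (- ?U) $$ (i, j)"
      unfolding sweep_coeff_rec using ij by (simp add: strict_lower_def)
    finally show "(?T * ?C) $$ (i, j) = (- ?U) $$ (i, j)" .
  qed (use T U in auto)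
  have "?C = B * ?T * ?C" using BT C by simp
  also have "\<dots> = B * (- ?U)" using assoc_mult_mat[OF Bc T C] TC by simp
  also have "\<dots> = - (B * ?U)" using Bc U by (intro uminus_mult_right_mat) auto
  finally show ?thesis unfolding C_mat_def B by simp
qed

section \<open>Bounds for the averaged recursion\<close>

lemma vec_norm2_square: "(vec_norm2 v)\<^sup>2 = (\<Sum>i<dim_vec v. (v $ i)\<^sup>2)"
  by (simp add: vec_norm2_def L2_set_def sum_nonneg)

lemma frob_norm_mat: "(frob_norm (mat n n (\<lambda>(i, j). c i j)))\<^sup>2 = (\<Sum>i<n. \<Sum>j<n. (c i j)\<^sup>2)"
  by (auto simp: frob_norm_def L2_set_def sum_nonneg sum.cartesian_product intro!: sum.cong)

lemma mat_mult_ones_norm: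
  "(vec_norm2 (mat n n (\<lambda>(i, j). c i j) *\<^sub>v ones_vec n))\<^sup>2 = (\<Sum>i<n. (\<Sum>j<n. c i j)\<^sup>2)"
  by (simp add: vec_norm2_square ones_vec_def scalar_prod_def atLeast0LessThan)

lemma transpose_mult_ones_norm:
  "(vec_norm2 (transpose_mat (mat n n (\<lambda>(i, j). c i j)) *\<^sub>v ones_vec n))\<^sup>2 = (\<Sum>j<n. (\<Sum>i<n. c i j)\<^sup>2)"
  by (simp add: vec_norm2_square ones_vec_def scalar_prod_def atLeast0LessThan)

lemma ones_mat_ones:
  "ones_vec n \<bullet> (mat n n (\<lambda>(i, j). c i j) *\<^sub>v ones_vec n) = (\<Sum>j<n. \<Sum>i<n. c i j)"
  unfolding sum.swap[of "\<lambda>j i. c i j"]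
  by (simp add: ones_vec_def scalar_prod_def atLeast0LessThan)

text \<open>Row sums govern the \<open>d\<close> coefficients and column sums the \<open>m\<close>
  coefficients. The second and fourth equations leave \<open>coef_d2\<close> and
  \<open>coef_m2\<close> folded, so that bounds on these can be reused.\<close>

lemma coef_eqs:
  fixes n :: nat and \<delta> :: real
  defines "c \<equiv> sweep_coeff \<delta>" and "C \<equiv> C_mat (A_mat n \<delta>)"
  shows "coef_d2 n C = ((\<Sum>i<n. (\<Sum>j<n. c i j)\<^sup>2) - (\<Sum>i<n. \<Sum>j<n. (c i j)\<^sup>2)) / (real n * (real n - 1))"
    and "coef_d1 n C = (\<Sum>i<n. \<Sum>j<n. (c i j)\<^sup>2) / real n - coef_d2 n C"
    and "coef_m2 n C = ((\<Sum>j<n. \<Sum>i<n. c i j)\<^sup>2 - (\<Sum>j<n. (\<Sum>i<n. c i j)\<^sup>2)) / (real n * (real n - 1))"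
    and "coef_m1 n C = (\<Sum>j<n. (\<Sum>i<n. c i j)\<^sup>2) / real n - coef_m2 n C"
  unfolding C_def c_def C_mat_A_mat coef_d2_def coef_d1_def coef_m2_def coef_m1_def
    frob_norm_mat mat_mult_ones_norm transpose_mult_ones_norm ones_mat_ones
  by simp_all

text \<open>The square of the sum, minus the diagonal, is a sum over the \<open>n (n - 1)\<close>
  ordered pairs of distinct indices. All \<open>u j\<close> have the same sign, so each product lies
  between 0 and \<open>b^2\<close>. The last inequality is Cauchy-Schwarz.\<close>

lemma sum_square_bounds:
  fixes u :: "nat \<Rightarrow> real"
  assumes "\<And>j. j < n \<Longrightarrow> - b \<le> u j" "\<And>j. j < n \<Longrightarrow> u j \<le> 0"
  shows "(\<Sum>j<n. (u j)\<^sup>2) \<le> (\<Sum>j<n. u j)\<^sup>2"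
    and "(\<Sum>j<n. u j)\<^sup>2 - (\<Sum>j<n. (u j)\<^sup>2) \<le> real n * (real n - 1) * b\<^sup>2"
    and "(\<Sum>j<n. (u j)\<^sup>2) \<le> real n * b\<^sup>2"
    and "(\<Sum>j<n. u j)\<^sup>2 \<le> real n * (\<Sum>j<n. (u j)\<^sup>2)"
proof -
  have b: "b \<ge> 0" if "n > 0" using assms[OF that] by linarith
  have pr: "u j * u k \<ge> 0" "u j * u k \<le> b\<^sup>2" if "j < n" "k < n" for j k
  proof -
    have "(- u j) * (- u k) \<ge> 0" "(- u j) * (- u k) \<le> b * b" using that assms[of j] assms[of k] b
      by (intro mult_nonneg_nonneg mult_mono; linarith)+
    then show "u j * u k \<ge> 0" "u j * u k \<le> b\<^sup>2" by (simp_all add: power2_eq_square)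
  qed
  have split: "(\<Sum>j<n. u j)\<^sup>2 - (\<Sum>j<n. (u j)\<^sup>2) = (\<Sum>j<n. \<Sum>k\<in>{..<n} - {j}. u j * u k)"
    by (simp add: power2_eq_square sum_product sum_subtractf[symmetric] sum_diff1)
  have "(\<Sum>j<n. \<Sum>k\<in>{..<n} - {j}. u j * u k) \<ge> 0"
    using pr by (intro sum_nonneg) auto
  then show "(\<Sum>j<n. (u j)\<^sup>2) \<le> (\<Sum>j<n. u j)\<^sup>2" using split by linarith
  have "(\<Sum>j<n. \<Sum>k\<in>{..<n} - {j}. u j * u k) \<le> (\<Sum>j<n. \<Sum>k\<in>{..<n} - {j}. b\<^sup>2)"
    using pr by (intro sum_mono) auto
  also have "\<dots> = real n * (real n - 1) * b\<^sup>2" by (cases n) (simp_all)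
  finally show "(\<Sum>j<n. u j)\<^sup>2 - (\<Sum>j<n. (u j)\<^sup>2) \<le> real n * (real n - 1) * b\<^sup>2" using split by linarith
  have "(\<Sum>j<n. (u j)\<^sup>2) \<le> (\<Sum>j<n. b\<^sup>2)"
    using pr by (intro sum_mono) (auto simp: power2_eq_square)
  then show "(\<Sum>j<n. (u j)\<^sup>2) \<le> real n * b\<^sup>2" by simp
  show "(\<Sum>j<n. u j)\<^sup>2 \<le> real n * (\<Sum>j<n. (u j)\<^sup>2)"
    using sum_squared_le_sum_of_squares[of u "{..<n}"] by (simp add: mult.commute)
qed

text \<open>The column sums of \<open>C\<close> are \<open>\<delta> ^ n - \<delta> ^ (n - j)\<close>
  and lie in \<open>[-\<delta>, 0]\<close>, so \<open>sum_square_bounds\<close> applies to them with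
  \<open>b = \<delta>\<close>.\<close>

lemma coef_m_bounds:
  assumes "n \<ge> 2" "0 \<le> \<delta>" "\<delta> \<le> 1"
  shows "0 \<le> coef_m1 n (C_mat (A_mat n \<delta>))" "coef_m1 n (C_mat (A_mat n \<delta>)) \<le> \<delta>\<^sup>2"
    and "0 \<le> coef_m2 n (C_mat (A_mat n \<delta>))" "coef_m2 n (C_mat (A_mat n \<delta>)) \<le> \<delta>\<^sup>2"
proof -
  let ?m1 = "coef_m1 n (C_mat (A_mat n \<delta>))" and ?m2 = "coef_m2 n (C_mat (A_mat n \<delta>))"
  define u where "u j = (\<Sum>i<n. sweep_coeff \<delta> i j)" for j
  define H K where "H = (\<Sum>j<n. (u j)\<^sup>2)" and "K = (\<Sum>j<n. u j)\<^sup>2"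
  have u: "- \<delta> \<le> u j" "u j \<le> 0" if "j < n" for j
  proof -
    have "u j = \<delta> ^ n - \<delta> ^ (n - j)" using that by (simp add: u_def sum_sweep_coeff_column)
    moreover have "\<delta> ^ n \<le> \<delta> ^ (n - j)" using assms by (intro power_decreasing) auto
    \<comment> \<open>Columns are counted from 0, so the exponent \<open>n - j\<close> is at least
      1.\<close>
    moreover have "\<delta> ^ (n - j) \<le> \<delta>" using assms that power_decreasing[of 1 "n - j" \<delta>] by simp
    moreover have "0 \<le> \<delta> ^ n" using assms by simp
    ultimately show "- \<delta> \<le> u j" "u j \<le> 0" by linarith+
  qed
  note bd = sum_square_bounds[of n \<delta> u, OF u, folded H_def K_def]
  have m2: "?m2 = (K - H) / (real n * (real n - 1))"
    unfolding coef_eqs H_def K_def u_def ..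
  have m1: "?m1 = H / real n - ?m2"
    unfolding coef_eqs(4) H_def u_def ..
  have pos: "real n > 0" "real n * (real n - 1) > 0" using assms by auto
  show 2: "0 \<le> ?m2" "?m2 \<le> \<delta>\<^sup>2"
    unfolding m2 using bd pos by (auto simp: field_simps)
  have "H / real n \<le> \<delta>\<^sup>2" using bd pos by (simp add: field_simps)
  then show "?m1 \<le> \<delta>\<^sup>2" using 2 m1 by linarith
  \<comment> \<open>Cleared of denominators, nonnegativity of \<open>m1\<close> is the
    Cauchy-Schwarz inequality for the column sums.\<close>
  have "?m1 * (real n * (real n - 1)) = real n * H - K"
    unfolding m1 m2 using pos by (simp add: divide_simps) (simp add: algebra_simps)
  with bd(4) pos show "0 \<le> ?m1" by (metis diff_ge_0_iff_ge zero_le_mult_iff not_less)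
qed

text \<open>A row of \<open>C\<close> can contain entries of both signs, so the argument used for
  column sums does not transfer. Instead \<open>N\<close>, the squared norm of \<open>C 1\<close>,
  and \<open>F\<close>, the squared Frobenius norm, are evaluated exactly by the geometric sums
  \<open>E\<close> and \<open>G\<close>. After multiplication by \<open>n (n - 1)\<close> the
  coefficients \<open>d1\<close> and \<open>d2\<close> become \<open>n F - N\<close> and
  \<open>N - F\<close>; times \<open>1 + \<delta>\<close>, each is compared with
  \<open>n (n - 1) (1 - \<delta>)\<close>.\<close>

lemma coef_d_bounds:
  assumes "n \<ge> 10" "0 \<le> \<delta>" "\<delta> \<le> 2/5"
  shows "0 \<le> coef_d1 n (C_mat (A_mat n \<delta>))" "coef_d1 n (C_mat (A_mat n \<delta>)) \<le> (1 - \<delta>) / (1 + \<delta>)"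
    and "0 \<le> coef_d2 n (C_mat (A_mat n \<delta>))" "coef_d2 n (C_mat (A_mat n \<delta>)) \<le> (1 - \<delta>) / (1 + \<delta>)"
proof -
  let ?d1 = "coef_d1 n (C_mat (A_mat n \<delta>))" and ?d2 = "coef_d2 n (C_mat (A_mat n \<delta>))"
  define r where "r i = (\<Sum>j<n. sweep_coeff \<delta> i j)" for i
  define q where "q i = (\<Sum>j<n. (sweep_coeff \<delta> i j)\<^sup>2)" for i
  define N F where "N = (\<Sum>i<n. (r i)\<^sup>2)" and "F = (\<Sum>i<n. q i)"
  define E G where "E = (\<Sum>k<n. \<delta> ^ k)" and "G = (\<Sum>k<n. \<delta> ^ (2 * k))"
  define p s where "p = \<delta> ^ n" and "s = 1 - \<delta>"
  define m where "m = real n"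
  have m: "m \<ge> 10" using assms(1) by (simp add: m_def)
  have E: "s * E = 1 - p" unfolding E_def p_def s_def by (rule geometric_sum)
  have G: "s * (1 + \<delta>) * G = 1 - p\<^sup>2"
  proof -
    have "s * (1 + \<delta>) = 1 - \<delta>\<^sup>2" by (simp add: s_def power2_eq_square algebra_simps)
    moreover have "p\<^sup>2 = \<delta> ^ (2 * n)" by (simp add: p_def power_mult[symmetric] mult.commute)
    ultimately show ?thesis unfolding G_def by (simp add: geometric_sum_square)
  qed
  have N: "N = m - 2 * (\<delta> + m * s) * E + (\<delta> + m * s)\<^sup>2 * G"
  proof -
    have "(r i)\<^sup>2 = 1 - 2 * (\<delta> + m * s) * \<delta> ^ i + (\<delta> + m * s)\<^sup>2 * \<delta> ^ (2 * i)" if "i < n" for i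
    proof -
      have "r i = 1 - (\<delta> + m * s) * \<delta> ^ i"
        using that by (simp add: r_def sum_sweep_coeff_row s_def m_def algebra_simps)
      moreover have "\<delta> ^ (2 * i) = (\<delta> ^ i)\<^sup>2" by (simp add: power_mult[symmetric] mult.commute)
      ultimately show ?thesis by (simp only: power2_diff power_mult_distrib) simp
    qed
    then have "N = (\<Sum>i<n. 1 - 2 * (\<delta> + m * s) * \<delta> ^ i + (\<delta> + m * s)\<^sup>2 * \<delta> ^ (2 * i))"
      unfolding N_def by (intro sum.cong) auto
    then show ?thesis
      unfolding sum.distrib sum_subtractf sum_distrib_left[symmetric] E_def G_def m_def by simp
  qed
  have F: "(1 + \<delta>) * F = s * (m - \<delta>\<^sup>2 * G) - 2 * (1 + \<delta>) * s * (E - \<delta> * G) + m * s\<^sup>2 * (1 + \<delta>) * G"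
  proof -
    have "(1 + \<delta>) * F = (\<Sum>i<n. s * (1 - \<delta>\<^sup>2 * \<delta> ^ (2 * i)) - 2 * (1 + \<delta>) * s * (\<delta> ^ i - \<delta> * \<delta> ^ (2 * i))
      + m * s\<^sup>2 * (1 + \<delta>) * \<delta> ^ (2 * i))"
      unfolding F_def sum_distrib_left q_def s_def m_def
      by (intro sum.cong refl sum_sweep_coeff_row_square[unfolded sum_distrib_left]) simp
    then show ?thesis
      unfolding sum.distrib sum_subtractf sum_distrib_left[symmetric] E_def G_def m_def by simp
  qed
  have d2: "?d2 = (N - F) / (m * (m - 1))"
    unfolding coef_eqs N_def F_def r_def q_def m_def ..
  have d1: "?d1 = F / m - ?d2"
    unfolding coef_eqs(2) F_def q_def m_def ..
  have pos: "m * (m - 1) > 0" "m > 0" using m by auto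
  have d1': "?d1 * (m * (m - 1)) = m * F - N"
    unfolding d1 d2 using m by (simp add: divide_simps) (simp add: algebra_simps)
  \<comment> \<open>The bound is coarse, as \<open>(2/5)^10\<close> is about 0.0001; it is the
    source of the factor 99/100 below.\<close>
  have p: "0 \<le> p" "p \<le> 1/100"
  proof -
    show "0 \<le> p" using assms by (simp add: p_def)
    have "p \<le> \<delta> ^ 10" unfolding p_def using assms by (intro power_decreasing) auto
    also have "\<dots> \<le> (2/5) ^ 10" using assms by (intro power_mono) auto
    finally show "p \<le> 1/100" by (simp add: power_divide)
  qed
  have s: "s \<ge> 3/5" "s \<le> 1" "\<delta> = 1 - s" using assms by (auto simp: s_def)
  have E1: "0 \<le> E" "E \<le> 5/3"
  proof -
    show "0 \<le> E" unfolding E_def using assms by (intro sum_nonneg) auto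
    then have "3/5 * E \<le> s * E" using s by (intro mult_right_mono)
    then show "E \<le> 5/3" using E p by simp
  qed
  have G1: "1 \<le> G"
  proof -
    have "G = (\<Sum>k\<in>insert 0 ({..<n} - {0}). \<delta> ^ (2 * k))"
      unfolding G_def using assms by (intro sum.cong) auto
    also have "\<dots> = 1 + (\<Sum>k\<in>{..<n} - {0}. \<delta> ^ (2 * k))" by (subst sum.insert) auto
    finally show ?thesis using assms by (simp add: sum_nonneg)
  qed
  \<comment> \<open>This is Cauchy-Schwarz in each row of \<open>C\<close>, summed over the
    rows.\<close>
  have "m * F - N \<ge> 0"
  proof -
    have "N \<le> (\<Sum>i<n. m * q i)" unfolding N_def
    proof (intro sum_mono)
      fix i show "(r i)\<^sup>2 \<le> m * q i"
        using sum_squared_le_sum_of_squares[of "sweep_coeff \<delta> i" "{..<n}"]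
        by (simp add: r_def q_def m_def mult.commute)
    qed
    then show ?thesis by (simp add: F_def sum_distrib_left)
  qed
  then show "0 \<le> ?d1" using d1' pos by (metis zero_le_mult_iff not_less)
  have "(1 + \<delta>) * (m * F - N) = m * s * (m - \<delta>\<^sup>2 * G) - m * (1 + \<delta>) + 2 * \<delta> * (1 + \<delta>) * E - (1 + \<delta>) * \<delta>\<^sup>2 * G"
  proof -
    have "(1 + \<delta>) * (m * F - N) = m * ((1 + \<delta>) * F) - (1 + \<delta>) * N" by (simp add: algebra_simps)
    also have "\<dots> = m * s * (m - \<delta>\<^sup>2 * G) - m * (1 + \<delta>) + 2 * \<delta> * (1 + \<delta>) * E - (1 + \<delta>) * \<delta>\<^sup>2 * G"
      unfolding F N by (simp add: power2_eq_square algebra_simps)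
    finally show ?thesis .
  qed
  \<comment> \<open>The target is split off. Both subtracted terms are nonnegative, the first
    because \<open>(1 + \<delta>) * E\<close> is at most 7/3 and \<open>m\<close> at least
    10.\<close>
  also have "\<dots> = m * (m - 1) * s - 2 * \<delta> * (m - (1 + \<delta>) * E) - (m * s + 1 + \<delta>) * \<delta>\<^sup>2 * G"
    by (simp add: s_def algebra_simps)
  also have "\<dots> \<le> m * (m - 1) * s"
  proof -
    have "(1 + \<delta>) * E \<le> (7/5) * (5/3)" using assms E1 by (intro mult_mono) auto
    then have "2 * \<delta> * (m - (1 + \<delta>) * E) \<ge> 0" using m assms by (intro mult_nonneg_nonneg) auto
    moreover have "(m * s + 1 + \<delta>) * \<delta>\<^sup>2 * G \<ge> 0" using m s assms G1 by (intro mult_nonneg_nonneg add_nonneg_nonneg) auto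
    ultimately show ?thesis by linarith
  qed
  finally have "(1 + \<delta>) * (?d1 * (m * (m - 1))) \<le> m * (m - 1) * s" unfolding d1' .
  then have "(m * (m - 1)) * (?d1 * (1 + \<delta>)) \<le> (m * (m - 1)) * s" by (simp add: algebra_simps)
  then have "?d1 * (1 + \<delta>) \<le> s" using pos(1) by (rule mult_left_le_imp_le)
  then show "?d1 \<le> (1 - \<delta>) / (1 + \<delta>)" using assms by (simp add: s_def field_simps)
  have d2': "?d2 * (m * (m - 1)) = N - F" unfolding d2 using m by simp
  \<comment> \<open>The terms are grouped around \<open>s * E\<close> and
    \<open>s * (1 + \<delta>) * G\<close>, whose values \<open>1 - p\<close> and
    \<open>1 - p^2\<close> are close to 1.\<close>
  have key: "(1 + \<delta>) * (N - F) = 2 * m * \<delta> - 2 * (1 + \<delta>) * (\<delta> * E + (m - 1) * (s * E))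
      + (m * (m - 1) * s + 2 * \<delta> * (m - 1)) * (s * (1 + \<delta>) * G) + 2 * \<delta>\<^sup>2 * G"
  proof -
    have "(1 + \<delta>) * (N - F) = (1 + \<delta>) * N - (1 + \<delta>) * F" by (simp add: algebra_simps)
    also have "\<dots> = 2 * m * \<delta> - 2 * (1 + \<delta>) * (\<delta> * E + (m - 1) * (s * E))
      + (m * (m - 1) * s + 2 * \<delta> * (m - 1)) * (s * (1 + \<delta>) * G) + 2 * \<delta>\<^sup>2 * G"
      unfolding F N by (simp add: s_def power2_eq_square algebra_simps)
    finally show ?thesis .
  qed
  have sG: "s * (1 + \<delta>) * G \<le> 1" using G by simp
  have "G \<le> 5/3"
  proof -
    have "3/5 * G \<le> s * (1 + \<delta>) * G" using s assms G1 mult_mono[of "3/5" s 1 "1 + \<delta>"] by (intro mult_right_mono) auto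
    then show ?thesis using sG by simp
  qed
  have "(1 + \<delta>) * (N - F) \<le> m * (m - 1) * s"
  proof -
    \<comment> \<open>Naming the products reduces the estimate to linear arithmetic:
      \<open>M\<close> is the target, \<open>t\<close> the excess of the \<open>G\<close> term over
      it, and \<open>f0\<close> the part of the negative terms that absorbs the rest. The constant
      4/15 is \<open>(2/5)^2 * (5/3)\<close>, a bound for \<open>\<delta>^2 * G\<close>.\<close>
    have lin: "a - (2 * e + 2 * f) + b + 2 * g \<le> M"
      if "b \<le> M + t" "g \<le> 4/15" "e \<ge> 0" "f \<ge> f0" "a + t + 2 * (4/15) \<le> 2 * f0"
      for a b e f f0 g t M :: real
      using that by linarith
    have "(m * (m - 1) * s + 2 * \<delta> * (m - 1)) * (s * (1 + \<delta>) * G) \<le> (m * (m - 1) * s + 2 * \<delta> * (m - 1)) * 1"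
      using sG m s assms by (intro mult_left_mono add_nonneg_nonneg mult_nonneg_nonneg) auto
    then have 1: "(m * (m - 1) * s + 2 * \<delta> * (m - 1)) * (s * (1 + \<delta>) * G) \<le> m * (m - 1) * s + 2 * \<delta> * (m - 1)"
      by simp
    have "\<delta>\<^sup>2 * G \<le> (2/5)\<^sup>2 * (5/3)"
      using \<open>G \<le> 5/3\<close> G1 assms by (intro mult_mono power_mono) auto
    then have 2: "\<delta>\<^sup>2 * G \<le> 4/15" by (simp add: power2_eq_square)
    have 3: "(1 + \<delta>) * (\<delta> * E) \<ge> 0" using assms E1 by simp
    have 4: "(1 + \<delta>) * ((m - 1) * (1 - p)) \<ge> (1 + \<delta>) * ((m - 1) * (99/100))"
      using assms m p by (intro mult_left_mono) auto
    have 5: "2 * m * \<delta> + 2 * \<delta> * (m - 1) + 2 * (4/15) \<le> 2 * ((1 + \<delta>) * ((m - 1) * (99/100)))"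
    proof -
      \<comment> \<open>With \<open>q\<close> standing for the product \<open>\<delta> * m\<close>,
        the inequality is linear.\<close>
      have *: "4 * q - 2 * \<delta> + 2 * (4/15) \<le> 2 * (99/100 * (m - 1 + q - \<delta>))" if "q \<le> 2/5 * m" for q
        using that m assms(2) by argo
      have "2 * m * \<delta> + 2 * \<delta> * (m - 1) = 4 * (\<delta> * m) - 2 * \<delta>"
        and "(1 + \<delta>) * ((m - 1) * (99/100)) = 99/100 * (m - 1 + \<delta> * m - \<delta>)"
        by (simp_all add: field_simps)
      moreover have "\<delta> * m \<le> 2/5 * m" using assms m by (intro mult_right_mono) auto
      ultimately show ?thesis using * by simp
    qed
    have 6: "2 * (1 + \<delta>) * (\<delta> * E + (m - 1) * (1 - p)) = 2 * ((1 + \<delta>) * (\<delta> * E)) + 2 * ((1 + \<delta>) * ((m - 1) * (1 - p)))"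
      and 7: "2 * \<delta>\<^sup>2 * G = 2 * (\<delta>\<^sup>2 * G)"
      by (simp_all add: algebra_simps)
    show ?thesis unfolding key E 6 7 by (rule lin[OF 1 2 3 4 5])
  qed
  then have "(m * (m - 1)) * (?d2 * (1 + \<delta>)) \<le> (m * (m - 1)) * s" unfolding d2'[symmetric] by (simp add: algebra_simps)
  then have "?d2 * (1 + \<delta>) \<le> s" using pos(1) by (rule mult_left_le_imp_le)
  then show "?d2 \<le> (1 - \<delta>) / (1 + \<delta>)" using assms by (simp add: s_def field_simps)
  have "(1 + \<delta>) * (N - F) \<ge> 0"
  proof -
    \<comment> \<open>For \<open>m\<close> at least 10 the \<open>G\<close> term is at least
      \<open>(9/25) * 10 * (m - 1)\<close>, that is \<open>18/5 * (m - 1)\<close>. The subtracted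
      terms amount to at most \<open>14/5 * (m - 1) + 28/15\<close>.\<close>
    have "(m * (m - 1) * s + 2 * \<delta> * (m - 1)) * (s * (1 + \<delta>) * G) \<ge> (m * (m - 1) * (3/5)) * (3/5 * 1 * 1)"
      using G1 m s assms by (intro mult_mono add_increasing2 mult_nonneg_nonneg) auto
    moreover have "m * (m - 1) \<ge> 10 * (m - 1)" using m by (intro mult_right_mono) auto
    moreover have "(1 + \<delta>) * (\<delta> * E + (m - 1) * (s * E)) \<le> 7/5 * (2/5 * (5/3) + (m - 1) * 1)"
      unfolding E using assms E1 m p by (intro mult_mono add_mono mult_left_mono) auto
    moreover have "2 * m * \<delta> + 2 * \<delta>\<^sup>2 * G \<ge> 0" using m assms G1 by simp
    ultimately show ?thesis unfolding key using m by argo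
  qed
  then have "N - F \<ge> 0" using assms by (simp add: zero_le_mult_iff)
  then show "0 \<le> ?d2" unfolding d2 using pos by simp
qed

section \<open>Contraction of the two-dimensional recursion\<close>

lemma M_mat_carrier: "M_mat n \<delta> \<in> carrier_mat 2 2"
  by (simp add: M_mat_def Let_def mat_of_rows_list_def numeral_2_eq_2)

lemma M_mat_mult_vec:
  fixes n :: nat and \<delta> :: real
  defines "C \<equiv> C_mat (A_mat n \<delta>)"
  assumes v: "v \<in> carrier_vec 2"
  shows "M_mat n \<delta> *\<^sub>v v \<in> carrier_vec 2"
    and "(M_mat n \<delta> *\<^sub>v v) $ 0 = coef_d1 n C * v $ 0 + coef_m1 n C * v $ 1"
    and "(M_mat n \<delta> *\<^sub>v v) $ 1 = coef_d2 n C * v $ 0 + coef_m2 n C * v $ 1"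
proof -
  show "M_mat n \<delta> *\<^sub>v v \<in> carrier_vec 2"
    by (rule mult_mat_vec_carrier[OF M_mat_carrier v])
  show "(M_mat n \<delta> *\<^sub>v v) $ 0 = coef_d1 n C * v $ 0 + coef_m1 n C * v $ 1"
    and "(M_mat n \<delta> *\<^sub>v v) $ 1 = coef_d2 n C * v $ 0 + coef_m2 n C * v $ 1"
    using carrier_vecD[OF v]
    by (simp_all add: M_mat_def Let_def C_def mat_of_rows_list_def scalar_prod_def numeral_2_eq_2)
qed

text \<open>The factor is moved onto the vector, which suits inductions that generalize over
  \<open>v\<close>.\<close>

lemma M_mat_pow_Suc:
  assumes "v \<in> carrier_vec 2"
  shows "(M_mat n \<delta> ^\<^sub>m Suc l) *\<^sub>v v = (M_mat n \<delta> ^\<^sub>m l) *\<^sub>v (M_mat n \<delta> *\<^sub>v v)"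
  using assoc_mult_mat_vec[OF pow_carrier_mat[OF M_mat_carrier] M_mat_carrier assms] by simp

text \<open>\<open>M\<close> has nonnegative entries and row sums at most
  \<open>(1 - \<delta>)/(1 + \<delta>) + \<delta>^2\<close>, which bounds its operator norm for the
  maximum norm.\<close>

lemma M_mat_contraction:
  assumes "n \<ge> 10" "0 \<le> \<delta>" "\<delta> \<le> 2/5" "v \<in> carrier_vec 2" "\<bar>v $ 0\<bar> \<le> t" "\<bar>v $ 1\<bar> \<le> t"
  shows "\<bar>(M_mat n \<delta> *\<^sub>v v) $ 0\<bar> \<le> (1 - 2 * \<delta> + 4 * \<delta>\<^sup>2) * t"
    and "\<bar>(M_mat n \<delta> *\<^sub>v v) $ 1\<bar> \<le> (1 - 2 * \<delta> + 4 * \<delta>\<^sup>2) * t"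
proof -
  have rho: "(1 - \<delta>) / (1 + \<delta>) + \<delta>\<^sup>2 \<le> 1 - 2 * \<delta> + 4 * \<delta>\<^sup>2"
  proof -
    have "(1 - 2 * \<delta> + 3 * \<delta>\<^sup>2) * (1 + \<delta>) - (1 - \<delta>) = \<delta>\<^sup>2 * (1 + 3 * \<delta>)"
      by (simp add: power2_eq_square algebra_simps)
    also have "\<dots> \<ge> 0" using assms by simp
    finally show ?thesis using assms by (simp add: field_simps)
  qed
  have t: "t \<ge> 0" using assms by linarith
  have gen: "\<bar>d * v $ 0 + m * v $ 1\<bar> \<le> (1 - 2 * \<delta> + 4 * \<delta>\<^sup>2) * t"
    if "0 \<le> d" "d \<le> (1 - \<delta>) / (1 + \<delta>)" "0 \<le> m" "m \<le> \<delta>\<^sup>2" for d m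
  proof -
    have "\<bar>d * v $ 0 + m * v $ 1\<bar> \<le> d * \<bar>v $ 0\<bar> + m * \<bar>v $ 1\<bar>"
      using that abs_triangle_ineq[of "d * v $ 0" "m * v $ 1"] by (simp add: abs_mult)
    also have "\<dots> \<le> d * t + m * t" using that assms by (intro add_mono mult_left_mono)
    also have "\<dots> = (d + m) * t" by (simp add: algebra_simps)
    also have "\<dots> \<le> (1 - 2 * \<delta> + 4 * \<delta>\<^sup>2) * t" using that rho t by (intro mult_right_mono) auto
    finally show ?thesis .
  qed
  have d: "\<delta> \<le> 1" "n \<ge> 2" using assms by auto
  show "\<bar>(M_mat n \<delta> *\<^sub>v v) $ 0\<bar> \<le> (1 - 2 * \<delta> + 4 * \<delta>\<^sup>2) * t"
    and "\<bar>(M_mat n \<delta> *\<^sub>v v) $ 1\<bar> \<le> (1 - 2 * \<delta> + 4 * \<delta>\<^sup>2) * t"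
    unfolding M_mat_mult_vec[OF assms(4)]
    using coef_d_bounds[OF assms(1-3)] coef_m_bounds[OF d(2) assms(2) d(1)] by (blast intro: gen)+
qed

text \<open>The start vector has maximum norm at least 3/5, so contraction alone cannot produce the
  factor \<delta>. Here the large entry \<open>1 - \<delta>\<close> meets an \<open>m\<close>
  coefficient of size at most \<open>\<delta>^2\<close>. Spending one application of
  \<open>M\<close> on this explains the exponent \<open>l - 1\<close> in the final bounds.\<close>

lemma M_mat_first_step:
  fixes n :: nat and \<delta> :: real
  defines "v \<equiv> vec_of_list [\<delta>, 1 - \<delta>]"
  assumes "n \<ge> 10" "0 \<le> \<delta>" "\<delta> \<le> 2/5"
  shows "\<bar>(M_mat n \<delta> *\<^sub>v v) $ 0\<bar> \<le> \<delta>" "\<bar>(M_mat n \<delta> *\<^sub>v v) $ 1\<bar> \<le> \<delta>"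
proof -
  have v: "v \<in> carrier_vec 2" "v $ 0 = \<delta>" "v $ 1 = 1 - \<delta>"
    unfolding v_def by (auto intro: carrier_vecI)
  have gen: "\<bar>d * v $ 0 + m * v $ 1\<bar> \<le> \<delta>"
    if "0 \<le> d" "d \<le> (1 - \<delta>) / (1 + \<delta>)" "0 \<le> m" "m \<le> \<delta>\<^sup>2" for d m
  proof -
    have "d * \<delta> \<le> (1 - \<delta>) / (1 + \<delta>) * \<delta>" using that assms by (intro mult_right_mono)
    moreover have "m * (1 - \<delta>) \<le> \<delta>\<^sup>2 * (1 - \<delta>)" using that assms by (intro mult_right_mono) auto
    moreover have "(1 - \<delta>) / (1 + \<delta>) * \<delta> + \<delta>\<^sup>2 * (1 - \<delta>) \<le> \<delta>"
    proof -
      have "\<delta> * (1 + \<delta>) - (1 - \<delta>) * \<delta> - \<delta>\<^sup>2 * (1 - \<delta>) * (1 + \<delta>) = \<delta>\<^sup>2 * (1 + \<delta>\<^sup>2)"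
        by (simp add: power2_eq_square algebra_simps)
      also have "\<dots> \<ge> 0" by simp
      finally show ?thesis using assms by (simp add: field_simps)
    qed
    moreover have "d * \<delta> \<ge> 0" "m * (1 - \<delta>) \<ge> 0" using that assms by simp_all
    ultimately show ?thesis unfolding v by linarith
  qed
  have d: "\<delta> \<le> 1" "n \<ge> 2" using assms by auto
  show "\<bar>(M_mat n \<delta> *\<^sub>v v) $ 0\<bar> \<le> \<delta>" "\<bar>(M_mat n \<delta> *\<^sub>v v) $ 1\<bar> \<le> \<delta>"
    unfolding M_mat_mult_vec[OF v(1)]
    using coef_d_bounds[OF assms(2-4)] coef_m_bounds[OF d(2) assms(3) d(1)] by (blast intro: gen)+
qed

lemma M_mat_pow_bound:
  assumes "n \<ge> 10" "0 \<le> \<delta>" "\<delta> \<le> 2/5" "v \<in> carrier_vec 2" "\<bar>v $ 0\<bar> \<le> t" "\<bar>v $ 1\<bar> \<le> t"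
  shows "\<bar>((M_mat n \<delta> ^\<^sub>m l) *\<^sub>v v) $ 0\<bar> \<le> (1 - 2 * \<delta> + 4 * \<delta>\<^sup>2) ^ l * t
    \<and> \<bar>((M_mat n \<delta> ^\<^sub>m l) *\<^sub>v v) $ 1\<bar> \<le> (1 - 2 * \<delta> + 4 * \<delta>\<^sup>2) ^ l * t"
  using assms(4-6)
proof (induction l arbitrary: v t)
  case 0
  moreover have "dim_row (M_mat n \<delta>) = 2" using M_mat_carrier by blast
  ultimately show ?case by simp
next
  case (Suc l)
  from Suc.IH[OF M_mat_mult_vec(1)[OF Suc.prems(1)] M_mat_contraction[OF assms(1-3) Suc.prems]]
  show ?case unfolding M_mat_pow_Suc[OF Suc.prems(1)] by (simp add: mult_ac)
qed

lemma eta_nu_bound: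
  assumes "n \<ge> 10" "0 \<le> \<delta>" "\<delta> \<le> 2/5" "l \<ge> 1"
  shows "\<bar>eta n \<delta> l\<bar> \<le> (1 - 2 * \<delta> + 4 * \<delta>\<^sup>2) ^ (l - 1) * \<delta>"
    and "\<bar>nu n \<delta> l\<bar> \<le> (1 - 2 * \<delta> + 4 * \<delta>\<^sup>2) ^ (l - 1) * \<delta>"
proof -
  obtain k where k: "l = Suc k" using assms(4) by (cases l) auto
  have v: "vec_of_list [\<delta>, 1 - \<delta>] \<in> carrier_vec 2" by (rule carrier_vecI) simp
  show "\<bar>eta n \<delta> l\<bar> \<le> (1 - 2 * \<delta> + 4 * \<delta>\<^sup>2) ^ (l - 1) * \<delta>"
    and "\<bar>nu n \<delta> l\<bar> \<le> (1 - 2 * \<delta> + 4 * \<delta>\<^sup>2) ^ (l - 1) * \<delta>"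
    using M_mat_pow_bound[OF assms(1-3) M_mat_mult_vec(1)[OF v] M_mat_first_step[OF assms(1-3)], of k]
    unfolding eta_def nu_def eta_nu_def k M_mat_pow_Suc[OF v] by simp_all
qed

section \<open>Averaging over permutations\<close>

text \<open>Composition with a transposition is an involution of the set of permutations.\<close>

lemma sum_permutations_transpose:
  fixes f :: "(nat \<Rightarrow> nat) \<Rightarrow> real"
  assumes "j < n" "k < n"
  shows "(\<Sum>p | p permutes {..<n}. f (p \<circ> Transposition.transpose j k)) = (\<Sum>p | p permutes {..<n}. f p)"
proof -
  have "p \<circ> Transposition.transpose j k permutes {..<n}" if "p permutes {..<n}" for p
    using that assms by (intro permutes_compose permutes_swap_id) auto
  then show ?thesis
    by (intro sum.reindex_bij_witness[of _ "\<lambda>p. p \<circ> Transposition.transpose j k" "\<lambda>p. p \<circ> Transposition.transpose j k"])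
      (auto simp: comp_assoc)
qed

lemma sum_comp_permutes:
  fixes f :: "nat \<Rightarrow> real"
  assumes "p permutes A"
  shows "(\<Sum>i\<in>A. f (p i)) = (\<Sum>i\<in>A. f i)"
  using sum.permute[OF assms, of f] by simp

text \<open>By symmetry the sum over \<open>p\<close> is the same for every position
  \<open>j\<close>. Summed over all positions, each of the \<open>n!\<close> permutations
  contributes the full sum of \<open>f\<close>.\<close>

lemma sum_permutations_apply:
  fixes f :: "nat \<Rightarrow> real"
  assumes "j < n"
  shows "real n * (\<Sum>p | p permutes {..<n}. f (p j)) = fact n * (\<Sum>i<n. f i)"
proof -
  have "(\<Sum>p | p permutes {..<n}. f (p k)) = (\<Sum>p | p permutes {..<n}. f (p j))" if "k < n" for k
    using sum_permutations_transpose[OF assms that, of "\<lambda>p. f (p j)"] by simp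
  then have "real n * (\<Sum>p | p permutes {..<n}. f (p j)) = (\<Sum>k<n. \<Sum>p | p permutes {..<n}. f (p k))"
    by simp
  also have "\<dots> = (\<Sum>p | p permutes {..<n}. \<Sum>k<n. f (p k))" by (rule sum.swap)
  also have "\<dots> = (\<Sum>p | p permutes {..<n}. \<Sum>k<n. f k)"
    by (intro sum.cong refl sum_comp_permutes) auto
  also have "\<dots> = fact n * (\<Sum>i<n. f i)" using card_permutations[of "{..<n}" n] by simp
  finally show ?thesis .
qed

text \<open>Exchanging \<open>k\<close> with another position \<open>l\<close> different from
  \<open>j\<close> leaves \<open>p j\<close> alone, so all \<open>n - 1\<close> choices of the
  second position give the same sum. Adding them up completes the second factor to the full sum of
  \<open>x\<close> minus \<open>x (p j)\<close>.\<close>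

lemma sum_permutations_apply_mult:
  fixes x :: "nat \<Rightarrow> real"
  assumes "j < n" "k < n" "j \<noteq> k"
  shows "real n * (real n - 1) * (\<Sum>p | p permutes {..<n}. x (p j) * x (p k))
    = fact n * ((\<Sum>i<n. x i)\<^sup>2 - (\<Sum>i<n. (x i)\<^sup>2))"
proof -
  let ?S = "\<Sum>i<n. x i"
  have "(\<Sum>p | p permutes {..<n}. x (p j) * x (p l)) = (\<Sum>p | p permutes {..<n}. x (p j) * x (p k))"
    if "l \<in> {..<n} - {j}" for l
    using that assms(3) sum_permutations_transpose[OF assms(2), of l "\<lambda>p. x (p j) * x (p k)"] by simp
  then have "(\<Sum>l\<in>{..<n} - {j}. \<Sum>p | p permutes {..<n}. x (p j) * x (p l))
      = (\<Sum>l\<in>{..<n} - {j}. \<Sum>p | p permutes {..<n}. x (p j) * x (p k))"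
    by (rule sum.cong[OF refl])
  then have "(real n - 1) * (\<Sum>p | p permutes {..<n}. x (p j) * x (p k))
      = (\<Sum>l\<in>{..<n} - {j}. \<Sum>p | p permutes {..<n}. x (p j) * x (p l))"
    using assms by (simp add: of_nat_diff)
  also have "\<dots> = (\<Sum>p | p permutes {..<n}. \<Sum>l\<in>{..<n} - {j}. x (p j) * x (p l))" by (rule sum.swap)
  also have "\<dots> = (\<Sum>p | p permutes {..<n}. ?S * x (p j) - (x (p j))\<^sup>2)"
  proof (intro sum.cong refl)
    fix p assume "p \<in> {p. p permutes {..<n}}"
    then have S: "(\<Sum>l<n. x (p l)) = ?S" by (intro sum_comp_permutes) simp
    have "(\<Sum>l\<in>{..<n} - {j}. x (p j) * x (p l)) = x (p j) * (\<Sum>l<n. x (p l)) - x (p j) * x (p j)"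
      using assms by (simp add: sum_distrib_left sum_diff1)
    then show "(\<Sum>l\<in>{..<n} - {j}. x (p j) * x (p l)) = ?S * x (p j) - (x (p j))\<^sup>2"
      unfolding S by (simp add: power2_eq_square mult.commute)
  qed
  also have "\<dots> = ?S * (\<Sum>p | p permutes {..<n}. x (p j)) - (\<Sum>p | p permutes {..<n}. (x (p j))\<^sup>2)"
    by (simp add: sum_subtractf sum_distrib_left)
  finally have *: "(real n - 1) * (\<Sum>p | p permutes {..<n}. x (p j) * x (p k))
      = ?S * (\<Sum>p | p permutes {..<n}. x (p j)) - (\<Sum>p | p permutes {..<n}. (x (p j))\<^sup>2)" .
  have "real n * ((real n - 1) * (\<Sum>p | p permutes {..<n}. x (p j) * x (p k)))
      = ?S * (real n * (\<Sum>p | p permutes {..<n}. x (p j))) - real n * (\<Sum>p | p permutes {..<n}. (x (p j))\<^sup>2)"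
    unfolding * by (simp add: right_diff_distrib mult.left_commute)
  also have "\<dots> = fact n * (?S\<^sup>2 - (\<Sum>i<n. (x i)\<^sup>2))"
    using sum_permutations_apply[OF assms(1), of x] sum_permutations_apply[OF assms(1), of "\<lambda>i. (x i)\<^sup>2"]
    by (simp add: power2_eq_square algebra_simps)
  finally show ?thesis by (simp add: mult.assoc)
qed

text \<open>The average of \<open>x (p j) * x (p k)\<close> takes only two values, one for
  \<open>j = k\<close> and one for all other pairs. The averaged form therefore depends on
  \<open>q\<close> only through its trace \<open>t\<close> and total sum \<open>w\<close>, in the
  pattern that defines \<open>d1, d2\<close> and \<open>m1, m2\<close>.\<close>

lemma average_permutations_quadratic_form:
  fixes x :: "nat \<Rightarrow> real" and q :: "nat \<Rightarrow> nat \<Rightarrow> real"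
  assumes "n \<ge> 2"
  defines "t \<equiv> \<Sum>j<n. q j j" and "w \<equiv> \<Sum>j<n. \<Sum>k<n. q j k"
  shows "(\<Sum>p | p permutes {..<n}. \<Sum>j<n. \<Sum>k<n. q j k * (x (p j) * x (p k))) / fact n
    = (t / real n - (w - t) / (real n * (real n - 1))) * (\<Sum>i<n. (x i)\<^sup>2)
      + (w - t) / (real n * (real n - 1)) * (\<Sum>i<n. x i)\<^sup>2"
proof -
  let ?a = "real n * (real n - 1)" and ?Q = "\<Sum>i<n. (x i)\<^sup>2" and ?S = "(\<Sum>i<n. x i)\<^sup>2"
  \<comment> \<open>The off-diagonal value is used for all pairs and corrected on the diagonal, so
    that the double sum splits into a \<open>w\<close> part and a \<open>t\<close> part.\<close>
  have pair: "?a * (\<Sum>p | p permutes {..<n}. x (p j) * x (p k))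
      = fact n * ((?S - ?Q) + (if j = k then real n * ?Q - ?S else 0))" if "j < n" "k < n" for j k
  proof (cases "j = k")
    case True
    have "?a * (\<Sum>p | p permutes {..<n}. x (p j) * x (p k)) = (real n - 1) * (fact n * ?Q)"
      using sum_permutations_apply[OF that(1), of "\<lambda>i. (x i)\<^sup>2"] True by (simp add: power2_eq_square mult_ac)
    then show ?thesis using True by (simp add: algebra_simps)
  qed (use sum_permutations_apply_mult[OF that] in simp)
  have "?a * (\<Sum>p | p permutes {..<n}. \<Sum>j<n. \<Sum>k<n. q j k * (x (p j) * x (p k)))
      = (\<Sum>j<n. \<Sum>k<n. q j k * (?a * (\<Sum>p | p permutes {..<n}. x (p j) * x (p k))))"
    unfolding sum.swap[of _ _ "{p. p permutes {..<n}}"] sum_distrib_left by (simp add: mult_ac)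
  also have "\<dots> = (\<Sum>j<n. \<Sum>k<n. fact n * ((?S - ?Q) * q j k + (if j = k then (real n * ?Q - ?S) * q j j else 0)))"
  proof (intro sum.cong refl)
    fix j k assume "j \<in> {..<n}" "k \<in> {..<n}"
    then have "?a * (\<Sum>p | p permutes {..<n}. x (p j) * x (p k))
        = fact n * ((?S - ?Q) + (if j = k then real n * ?Q - ?S else 0))"
      by (intro pair) auto
    then show "q j k * (?a * (\<Sum>p | p permutes {..<n}. x (p j) * x (p k)))
        = fact n * ((?S - ?Q) * q j k + (if j = k then (real n * ?Q - ?S) * q j j else 0))"
      by (simp only:) (auto simp: algebra_simps)
  qed
  also have "\<dots> = fact n * ((?S - ?Q) * w + (real n * ?Q - ?S) * t)"
    by (simp add: sum_distrib_left[symmetric] sum.distrib w_def t_def)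
  finally have *: "?a * (\<Sum>p | p permutes {..<n}. \<Sum>j<n. \<Sum>k<n. q j k * (x (p j) * x (p k)))
    = fact n * ((?S - ?Q) * w + (real n * ?Q - ?S) * t)" .
  have "(\<Sum>p | p permutes {..<n}. \<Sum>j<n. \<Sum>k<n. q j k * (x (p j) * x (p k))) / fact n
    = ((?S - ?Q) * w + (real n * ?Q - ?S) * t) / ?a"
    using * assms(1) by (simp add: divide_simps mult_ac)
  also have "\<dots> = (t / real n - (w - t) / ?a) * ?Q + (w - t) / ?a * ?S"
    using assms(1) by (simp add: divide_simps) (simp add: algebra_simps)
  finally show ?thesis .
qed

text \<open>This is the quadratic form of \<open>v0 I + v1 1 1^T\<close>, the shape of every
  symmetric matrix invariant under simultaneous permutation of rows and columns. The argument is a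
  function, so relabelling coordinates is mere composition.\<close>

definition quad_pair :: "nat \<Rightarrow> real vec \<Rightarrow> (nat \<Rightarrow> real) \<Rightarrow> real" where
  "quad_pair n v x = v $ 0 * (\<Sum>i<n. (x i)\<^sup>2) + v $ 1 * (\<Sum>i<n. x i)\<^sup>2"

lemma quad_pair_permutes:
  assumes "p permutes {..<n}"
  shows "quad_pair n v (\<lambda>i. x (p i)) = quad_pair n v x"
  using sum_comp_permutes[OF assms, of x] sum_comp_permutes[OF assms, of "\<lambda>i. (x i)\<^sup>2"]
  by (simp add: quad_pair_def)

text \<open>Two forms are averaged. The squared norm of \<open>C y\<close> has matrix
  \<open>C^T C\<close> (here \<open>?q\<close>), with trace the squared Frobenius norm of
  \<open>C\<close> and total sum the squared norm of \<open>C 1\<close>. The square of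
  \<open>1^T C y\<close> has the rank-one matrix built from \<open>C^T 1\<close> (here
  \<open>?u\<close>). Their coefficients are the two columns of \<open>M\<close>.\<close>

lemma average_permutations_sweep:
  fixes x :: "nat \<Rightarrow> real"
  assumes "n \<ge> 2" and v: "v \<in> carrier_vec 2"
  shows "(\<Sum>p | p permutes {..<n}. quad_pair n v (\<lambda>i. \<Sum>j<n. sweep_coeff \<delta> i j * x (p j))) / fact n
    = quad_pair n (M_mat n \<delta> *\<^sub>v v) x"
proof -
  let ?c = "sweep_coeff \<delta>" and ?C = "C_mat (A_mat n \<delta>)"
  let ?q = "\<lambda>j k. \<Sum>i<n. ?c i j * ?c i k" and ?u = "\<lambda>j. \<Sum>i<n. ?c i j"
  have 1: "(\<Sum>i<n. (\<Sum>j<n. ?c i j * y j)\<^sup>2) = (\<Sum>j<n. \<Sum>k<n. ?q j k * (y j * y k))" for y :: "nat \<Rightarrow> real"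
  proof -
    have "(\<Sum>i<n. (\<Sum>j<n. ?c i j * y j)\<^sup>2) = (\<Sum>i<n. \<Sum>j<n. \<Sum>k<n. ?c i j * ?c i k * (y j * y k))"
      by (simp add: power2_eq_square sum_product mult_ac)
    also have "\<dots> = (\<Sum>j<n. \<Sum>i<n. \<Sum>k<n. ?c i j * ?c i k * (y j * y k))" by (rule sum.swap)
    also have "\<dots> = (\<Sum>j<n. \<Sum>k<n. \<Sum>i<n. ?c i j * ?c i k * (y j * y k))" by (intro sum.cong refl sum.swap)
    finally show ?thesis by (simp add: sum_distrib_right)
  qed
  have 2: "(\<Sum>i<n. \<Sum>j<n. ?c i j * y j)\<^sup>2 = (\<Sum>j<n. \<Sum>k<n. ?u j * ?u k * (y j * y k))" for y :: "nat \<Rightarrow> real"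
  proof -
    have "(\<Sum>i<n. \<Sum>j<n. ?c i j * y j) = (\<Sum>j<n. ?u j * y j)"
      by (subst sum.swap) (simp add: sum_distrib_right)
    then show ?thesis by (simp add: power2_eq_square sum_product mult_ac)
  qed
  have t1: "(\<Sum>j<n. ?q j j) = (\<Sum>i<n. \<Sum>j<n. (?c i j)\<^sup>2)"
    by (subst sum.swap) (simp add: power2_eq_square)
  have w1: "(\<Sum>j<n. \<Sum>k<n. ?q j k) = (\<Sum>i<n. (\<Sum>j<n. ?c i j)\<^sup>2)"
    using 1[of "\<lambda>_. 1"] by simp
  have t2: "(\<Sum>j<n. ?u j * ?u j) = (\<Sum>j<n. (?u j)\<^sup>2)" by (simp add: power2_eq_square)
  have w2: "(\<Sum>j<n. \<Sum>k<n. ?u j * ?u k) = (\<Sum>j<n. ?u j)\<^sup>2" by (simp add: power2_eq_square sum_product)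
  let ?P = "{p. p permutes {..<n}}"
  have "(\<Sum>p\<in>?P. quad_pair n v (\<lambda>i. \<Sum>j<n. ?c i j * x (p j))) / fact n
      = v $ 0 * ((\<Sum>p\<in>?P. \<Sum>j<n. \<Sum>k<n. ?q j k * (x (p j) * x (p k))) / fact n)
        + v $ 1 * ((\<Sum>p\<in>?P. \<Sum>j<n. \<Sum>k<n. ?u j * ?u k * (x (p j) * x (p k))) / fact n)"
    unfolding quad_pair_def 1 2 sum.distrib sum_distrib_left[symmetric] by (simp add: add_divide_distrib)
  also have "\<dots> = v $ 0 * (coef_d1 n ?C * (\<Sum>i<n. (x i)\<^sup>2) + coef_d2 n ?C * (\<Sum>i<n. x i)\<^sup>2)
        + v $ 1 * (coef_m1 n ?C * (\<Sum>i<n. (x i)\<^sup>2) + coef_m2 n ?C * (\<Sum>i<n. x i)\<^sup>2)"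
    unfolding average_permutations_quadratic_form[OF assms(1), where q = ?q and x = x]
      average_permutations_quadratic_form[OF assms(1), where q = "\<lambda>j k. ?u j * ?u k" and x = x]
      t1 t2 w1 w2 coef_eqs ..
  also have "\<dots> = quad_pair n (M_mat n \<delta> *\<^sub>v v) x"
    unfolding quad_pair_def M_mat_mult_vec[OF v] by (simp add: algebra_simps)
  finally show ?thesis .
qed

section \<open>Epochs of coordinate descent\<close>

lemma cd_iter_carrier [simp]:
  assumes "x0 \<in> carrier_vec n"
  shows "cd_iter n A \<pi> x0 k \<in> carrier_vec n"
  by (induction k) (use assms in \<open>auto simp: Let_def\<close>)

text \<open>The iterate after \<open>l\<close> epochs is a function of the first \<open>l\<close>
  permutations, which is what makes it independent of the next one.\<close>

lemma cd_iter_cong: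
  assumes "n > 0" "\<And>m. 1 \<le> m \<Longrightarrow> m \<le> l \<Longrightarrow> \<pi> m = \<pi>' m" "k \<le> l * n"
  shows "cd_iter n A \<pi> x0 k = cd_iter n A \<pi>' x0 k"
  using assms(3)
proof (induction k)
  case (Suc k)
  then have "k div n < l" using assms(1) by (simp add: less_mult_imp_div_less)
  then have "\<pi> (k div n + 1) = \<pi>' (k div n + 1)" by (intro assms(2)) auto
  with Suc show ?case by (simp add: Let_def)
qed simp

lemma A_mat_mult_vec_index:
  assumes "x \<in> carrier_vec n" "i < n"
  shows "(A_mat n \<delta> *\<^sub>v x) $ i = \<delta> * x $ i + (1 - \<delta>) * (\<Sum>j<n. x $ j)"
proof -
  have "(A_mat n \<delta> *\<^sub>v x) $ i = (\<Sum>j<n. (if i = j then 1 else 1 - \<delta>) * x $ j)"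
    using assms carrier_vecD[OF assms(1)] by (simp add: scalar_prod_def atLeast0LessThan)
  also have "\<dots> = (\<Sum>j<n. (1 - \<delta>) * x $ j + (if i = j then \<delta> * x $ j else 0))"
    by (intro sum.cong) (auto simp: algebra_simps)
  also have "\<dots> = \<delta> * x $ i + (1 - \<delta>) * (\<Sum>j<n. x $ j)"
    using assms(2) by (simp add: sum.distrib sum_distrib_left)
  finally show ?thesis .
qed

text \<open>The objective is half the invariant form whose coefficients are the start vector of the
  recursion for \<open>eta\<close> and \<open>nu\<close>.\<close>

lemma quad_obj_A_mat:
  assumes "x \<in> carrier_vec n"
  shows "quad_obj (A_mat n \<delta>) x = 1/2 * quad_pair n (vec_of_list [\<delta>, 1 - \<delta>]) (\<lambda>i. x $ i)"
proof -
  have "x \<bullet> (A_mat n \<delta> *\<^sub>v x) = (\<Sum>i<n. x $ i * (\<delta> * x $ i + (1 - \<delta>) * (\<Sum>j<n. x $ j)))"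
    using A_mat_mult_vec_index[OF assms] by (simp add: scalar_prod_def atLeast0LessThan)
  also have "\<dots> = \<delta> * (\<Sum>i<n. (x $ i)\<^sup>2) + (1 - \<delta>) * ((\<Sum>i<n. x $ i) * (\<Sum>j<n. x $ j))"
    by (simp add: sum_distrib_left sum_distrib_right sum.distrib power2_eq_square algebra_simps)
  finally show ?thesis by (simp add: quad_obj_def quad_pair_def power2_eq_square)
qed

text \<open>In visiting order a sweep is forward substitution: position \<open>k\<close> receives
  the solution of row \<open>k\<close> of \<open>(L + D) z = -L^T y\<close>, while later positions
  keep their values from the start of the epoch.\<close>

lemma cd_iter_within_epoch:
  assumes x0: "x0 \<in> carrier_vec n" and p: "\<pi> (Suc l) permutes {..<n}" and "k \<le> n" "i < n"
  shows "cd_iter n (A_mat n \<delta>) \<pi> x0 (l * n + k) $ \<pi> (Suc l) i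
    = (if i < k then \<Sum>j<n. sweep_coeff \<delta> i j * cd_iter n (A_mat n \<delta>) \<pi> x0 (l * n) $ \<pi> (Suc l) j
       else cd_iter n (A_mat n \<delta>) \<pi> x0 (l * n) $ \<pi> (Suc l) i)"
  using assms(3-4)
proof (induction k arbitrary: i)
  case 0
  then show ?case by simp
next
  case (Suc k)
  let ?p = "\<pi> (Suc l)" and ?X = "cd_iter n (A_mat n \<delta>) \<pi> x0 (l * n + k)"
  define y where "y j = cd_iter n (A_mat n \<delta>) \<pi> x0 (l * n) $ ?p j" for j
  define z where "z i = (\<Sum>j<n. sweep_coeff \<delta> i j * y j)" for i
  have k: "k < n" using Suc.prems by simp
  have dk: "(l * n + k) div n + 1 = Suc l" "(l * n + k) mod n = k" using k by simp_all
  have X: "?X \<in> carrier_vec n" using x0 by simp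
  have pin: "?p j < n" if "j < n" for j using permutes_in_image[OF p, of j] that by simp
  have IH: "?X $ ?p j = (if j < k then z j else y j)" if "j < n" for j
    using Suc.IH[of j] k that by (simp add: z_def y_def)
  \<comment> \<open>The coordinates are summed in visiting order: already updated, current, still
    untouched.\<close>
  have sumX: "(\<Sum>j<n. ?X $ j) = (\<Sum>j<k. z j) + y k + (\<Sum>j\<in>{k<..<n}. y j)"
  proof -
    have "(\<Sum>j<n. ?X $ j) = (\<Sum>j<n. ?X $ ?p j)" using sum_comp_permutes[OF p] by metis
    also have "\<dots> = (\<Sum>j<n. if j < k then z j else y j)" using IH by (intro sum.cong) auto
    also have "\<dots> = (\<Sum>j\<in>{..<k} \<union> insert k {k<..<n}. if j < k then z j else y j)"
      using k by (intro sum.cong) auto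
    also have "\<dots> = (\<Sum>j<k. if j < k then z j else y j) + (\<Sum>j\<in>insert k {k<..<n}. if j < k then z j else y j)"
      by (rule sum.union_disjoint) auto
    also have "\<dots> = (\<Sum>j<k. z j) + y k + (\<Sum>j\<in>{k<..<n}. y j)"
      by (simp cong: sum.cong_simp)
    finally show ?thesis .
  qed
  have zk: "z k = - (1 - \<delta>) * (\<Sum>j<k. z j) - (1 - \<delta>) * (\<Sum>j\<in>{k<..<n}. y j)"
  proof -
    have "z k + (1 - \<delta>) * (\<Sum>i<k. z i)
        = (\<Sum>j<n. (sweep_coeff \<delta> k j + (1 - \<delta>) * (\<Sum>i<k. sweep_coeff \<delta> i j)) * y j)"
      unfolding z_def by (subst sum.swap) (simp add: sum.distrib sum_distrib_left sum_distrib_right algebra_simps)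
    also have "\<dots> = (\<Sum>j<n. if k < j then - (1 - \<delta>) * y j else 0)"
      unfolding sweep_coeff_rec by (intro sum.cong) auto
    also have "\<dots> = (\<Sum>j\<in>{k<..<n}. - (1 - \<delta>) * y j)"
      by (intro sum.mono_neutral_cong_right) auto
    finally show ?thesis unfolding sum_distrib_left[symmetric] by (simp add: algebra_simps)
  qed
  have step: "cd_iter n (A_mat n \<delta>) \<pi> x0 (l * n + Suc k)
      = ?X - ((A_mat n \<delta> *\<^sub>v ?X) $ ?p k) \<cdot>\<^sub>v unit_vec n (?p k)"
    using dk by (simp add: Let_def)
  have val: "cd_iter n (A_mat n \<delta>) \<pi> x0 (l * n + Suc k) $ ?p i
      = ?X $ ?p i - ((A_mat n \<delta> *\<^sub>v ?X) $ ?p k) * (if i = k then 1 else 0)"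
    unfolding step using pin[OF Suc.prems(2)] pin[OF k] X permutes_inj[OF p]
    by (auto simp: inj_eq)
  \<comment> \<open>The partial derivative is old value minus new value, so the unit step writes
    exactly \<open>z k\<close>.\<close>
  have Ak: "(A_mat n \<delta> *\<^sub>v ?X) $ ?p k = y k - z k"
    unfolding A_mat_mult_vec_index[OF X pin[OF k]] sumX zk using IH[OF k] by (simp add: algebra_simps)
  show ?case
    unfolding val Ak IH[OF Suc.prems(2)] by (auto simp: z_def y_def less_Suc_eq)
qed

text \<open>Permutation invariance of the form allows the final iterate to be read in visiting
  order, which removes the outer factor \<open>P_l\<close> of \<open>P_l C P_l^T\<close>.\<close>

lemma quad_pair_cd_iter_epoch:
  assumes "x0 \<in> carrier_vec n" "\<pi> (Suc l) permutes {..<n}"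
  shows "quad_pair n v (\<lambda>i. cd_iter n (A_mat n \<delta>) \<pi> x0 (Suc l * n) $ i)
    = quad_pair n v (\<lambda>i. \<Sum>j<n. sweep_coeff \<delta> i j * cd_iter n (A_mat n \<delta>) \<pi> x0 (l * n) $ \<pi> (Suc l) j)"
proof -
  have "quad_pair n v (\<lambda>i. cd_iter n (A_mat n \<delta>) \<pi> x0 (Suc l * n) $ i)
      = quad_pair n v (\<lambda>i. cd_iter n (A_mat n \<delta>) \<pi> x0 (l * n + n) $ \<pi> (Suc l) i)"
    using quad_pair_permutes[OF assms(2), of v "\<lambda>i. cd_iter n (A_mat n \<delta>) \<pi> x0 (l * n + n) $ i"]
    by (simp add: add.commute)
  also have "\<dots> = quad_pair n v (\<lambda>i. \<Sum>j<n. sweep_coeff \<delta> i j * cd_iter n (A_mat n \<delta>) \<pi> x0 (l * n) $ \<pi> (Suc l) j)"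
    unfolding quad_pair_def using cd_iter_within_epoch[where \<pi> = \<pi> and l = l, OF assms le_refl] by simp
  finally show ?thesis .
qed

section \<open>Expectation\<close>

lemma (in finite_measure) integrable_finite_range:
  fixes h :: "'b \<Rightarrow> real"
  assumes "Y \<in> measurable M (count_space T)" "finite T"
  shows "integrable M (\<lambda>\<omega>. h (Y \<omega>))"
proof (rule integrable_const_bound[where B = "Max ((\<lambda>t. \<bar>h t\<bar>) ` T)"])
  show "AE \<omega> in M. norm (h (Y \<omega>)) \<le> Max ((\<lambda>t. \<bar>h t\<bar>) ` T)"
    using measurable_space[OF assms(1)] assms(2) by (intro AE_I2) (auto intro!: Max_ge)
  show "(\<lambda>\<omega>. h (Y \<omega>)) \<in> borel_measurable M"
    by (rule measurable_compose[OF assms(1)]) simp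
qed

text \<open>Splitting over the finitely many values of \<open>Z\<close> leaves products of a
  function of \<open>Y\<close> with an indicator of \<open>Z\<close>, and independence factors their
  expectations. \<open>Z\<close> is given as \<open>g \<circ> W\<close> because independence of
  groups of permutations is stated for whole families \<open>W\<close>, from which \<open>g\<close>
  picks a component.\<close>

lemma (in prob_space) expectation_indep_uniform:
  fixes h :: "'b \<Rightarrow> 'c \<Rightarrow> real"
  assumes indep: "indep_var (count_space T) Y N W" and g: "g \<in> measurable N (count_space S)"
    and "finite T" "finite S"
    and unif: "distr M (count_space S) Z = uniform_count_measure S" and "Z = g \<circ> W"
  shows "expectation (\<lambda>\<omega>. h (Y \<omega>) (Z \<omega>)) = expectation (\<lambda>\<omega>. (\<Sum>z\<in>S. h (Y \<omega>) z) / card S)"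
proof -
  have Y: "Y \<in> measurable M (count_space T)" and Z: "Z \<in> measurable M (count_space S)"
    using indep_var_rv1[OF indep] measurable_comp[OF indep_var_rv2[OF indep] g] \<open>Z = g \<circ> W\<close> by auto
  have one: "expectation (\<lambda>\<omega>. indicator {z} (Z \<omega>)) = 1 / card S" if "z \<in> S" for z
  proof -
    have "expectation (\<lambda>\<omega>. indicator {z} (Z \<omega>)) = (\<integral>y. indicator {z} y \<partial>distr M (count_space S) Z :: real)"
      by (rule integral_distr[symmetric, OF Z]) simp
    also have "\<dots> = measure (uniform_count_measure S) {z}"
      unfolding unif using that by (simp add: space_uniform_count_measure)
    also have "\<dots> = 1 / card S" using measure_uniform_count_measure[OF assms(4), of "{z}"] that by simp
    finally show ?thesis .
  qed
  have ind: "expectation (\<lambda>\<omega>. h (Y \<omega>) z * indicator {z} (Z \<omega>)) = expectation (\<lambda>\<omega>. h (Y \<omega>) z) * (1 / card S)"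
    and int: "integrable M (\<lambda>\<omega>. h (Y \<omega>) z * indicator {z} (Z \<omega>))" if "z \<in> S" for z
  proof -
    have iv: "indep_var borel (\<lambda>\<omega>. h (Y \<omega>) z) borel (\<lambda>\<omega>. indicator {z} (Z \<omega>) :: real)"
      using indep_var_compose[OF indep, of "\<lambda>y. h y z" borel "\<lambda>w. indicator {z} (g w)" borel]
        measurable_compose[OF g, of "indicator {z}" borel] \<open>Z = g \<circ> W\<close> by (simp add: comp_def)
    have i1: "integrable M (\<lambda>\<omega>. h (Y \<omega>) z)" by (rule integrable_finite_range[OF Y assms(3)])
    have i2: "integrable M (\<lambda>\<omega>. indicator {z} (Z \<omega>) :: real)" by (rule integrable_finite_range[OF Z assms(4)])
    show "expectation (\<lambda>\<omega>. h (Y \<omega>) z * indicator {z} (Z \<omega>)) = expectation (\<lambda>\<omega>. h (Y \<omega>) z) * (1 / card S)"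
      using indep_var_lebesgue_integral[OF iv i1 i2] one[OF that] by simp
    show "integrable M (\<lambda>\<omega>. h (Y \<omega>) z * indicator {z} (Z \<omega>))" by (rule indep_var_integrable[OF iv i1 i2])
  qed
  have "expectation (\<lambda>\<omega>. h (Y \<omega>) (Z \<omega>)) = expectation (\<lambda>\<omega>. \<Sum>z\<in>S. h (Y \<omega>) z * indicator {z} (Z \<omega>))"
  proof (rule Bochner_Integration.integral_cong[OF refl])
    fix \<omega> assume "\<omega> \<in> space M"
    then have "Z \<omega> \<in> S" using measurable_space[OF Z] by simp
    then show "h (Y \<omega>) (Z \<omega>) = (\<Sum>z\<in>S. h (Y \<omega>) z * indicator {z} (Z \<omega>))"
      using assms(4) by (simp add: indicator_def of_bool_def if_distrib cong: if_cong)
  qed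
  also have "\<dots> = (\<Sum>z\<in>S. expectation (\<lambda>\<omega>. h (Y \<omega>) z) * (1 / card S))"
    using int ind by simp
  also have "\<dots> = expectation (\<lambda>\<omega>. (\<Sum>z\<in>S. h (Y \<omega>) z) / card S)"
    using integrable_finite_range[OF Y assms(3), of "\<lambda>y. h y _"] by (simp add: sum_divide_distrib)
  finally show ?thesis .
qed

text \<open>The last epoch is averaged first, which replaces \<open>v\<close> by \<open>M v\<close>
  and leaves the same claim with one epoch fewer; hence the induction generalizes over
  \<open>v\<close>.\<close>

lemma expectation_quad_pair_cd_iter:
  assumes "n \<ge> 2" and x0: "x0 \<in> carrier_vec n" and "prob_space \<Omega>" and iid: "iid_uniform_perms n \<Omega> \<pi>"
    and "v \<in> carrier_vec 2"
  shows "prob_space.expectation \<Omega> (\<lambda>\<omega>. quad_pair n v (\<lambda>i. cd_iter n (A_mat n \<delta>) (\<lambda>m. \<pi> m \<omega>) x0 (l * n) $ i))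
    = quad_pair n ((M_mat n \<delta> ^\<^sub>m l) *\<^sub>v v) (\<lambda>i. x0 $ i)"
  using assms(5)
proof (induction l arbitrary: v)
  interpret prob_space \<Omega> by fact
  {
    case 0
    moreover have "dim_row (M_mat n \<delta>) = 2" using M_mat_carrier by blast
    ultimately show ?case by (simp add: prob_space)
  next
    case (Suc l)
    let ?P = "{p. p permutes {..<n}}" and ?T = "PiE {1..l} (\<lambda>_. {p. p permutes {..<n}})"
    let ?Y = "\<lambda>\<omega>. \<lambda>m\<in>{1..l}. \<pi> m \<omega>"
    let ?X = "\<lambda>\<xi>. cd_iter n (A_mat n \<delta>) \<xi> x0 (l * n)"
    have finP: "finite ?P" by (rule finite_permutations) simp
    have cardP: "card ?P = fact n" by (rule card_permutations) auto
    have iv: "indep_vars (\<lambda>_. count_space ?P) \<pi> {1..}"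
      and unif: "distr \<Omega> (count_space ?P) (\<pi> (Suc l)) = uniform_count_measure ?P"
      using iid by (auto simp: iid_uniform_perms_def)
    have pi: "\<pi> (Suc l) \<omega> permutes {..<n}" if "\<omega> \<in> space \<Omega>" for \<omega>
    proof -
      have "\<pi> (Suc l) \<in> measurable \<Omega> (count_space ?P)" using iv unfolding indep_vars_def by auto
      from measurable_space[OF this that] show ?thesis by simp
    qed
    \<comment> \<open>A finite product of finite discrete spaces is discrete, so every function of
      the first \<open>l\<close> permutations is measurable.\<close>
    have PiM: "PiM {1..l} (\<lambda>_. count_space ?P) = count_space ?T"
      by (rule count_space_PiM_finite) (auto intro: countable_finite finP)
    have indep: "indep_var (count_space ?T) ?Y
        (PiM {Suc l} (\<lambda>_. count_space ?P)) (\<lambda>\<omega>. \<lambda>m\<in>{Suc l}. \<pi> m \<omega>)"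
      unfolding PiM[symmetric] by (rule indep_var_restrict[OF iv]) auto
    have proj: "(\<lambda>f. f (Suc l)) \<in> measurable (PiM {Suc l} (\<lambda>_. count_space ?P)) (count_space ?P)"
      by (rule measurable_component_singleton) simp
    have XY: "?X (?Y \<omega>) = ?X (\<lambda>m. \<pi> m \<omega>)" for \<omega>
      using assms(1) by (intro cd_iter_cong[of _ l]) auto
    let ?h = "\<lambda>\<xi> p. quad_pair n v (\<lambda>i. \<Sum>j<n. sweep_coeff \<delta> i j * ?X \<xi> $ p j)"
    have "expectation (\<lambda>\<omega>. quad_pair n v (\<lambda>i. cd_iter n (A_mat n \<delta>) (\<lambda>m. \<pi> m \<omega>) x0 (Suc l * n) $ i))
        = expectation (\<lambda>\<omega>. ?h (?Y \<omega>) (\<pi> (Suc l) \<omega>))"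
      unfolding XY
      by (intro Bochner_Integration.integral_cong refl quad_pair_cd_iter_epoch[OF x0] pi)
    also have "\<dots> = expectation (\<lambda>\<omega>. (\<Sum>p\<in>?P. ?h (?Y \<omega>) p) / card ?P)"
      by (rule expectation_indep_uniform[OF indep proj _ finP unif])
        (auto intro!: finite_PiE finP simp: comp_def)
    also have "\<dots> = expectation (\<lambda>\<omega>. quad_pair n (M_mat n \<delta> *\<^sub>v v) (\<lambda>i. ?X (\<lambda>m. \<pi> m \<omega>) $ i))"
      unfolding XY cardP of_nat_fact average_permutations_sweep[OF assms(1) Suc.prems, of \<delta> "\<lambda>i. ?X _ $ i"] ..
    also have "\<dots> = quad_pair n ((M_mat n \<delta> ^\<^sub>m Suc l) *\<^sub>v v) (\<lambda>i. x0 $ i)"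
      unfolding M_mat_pow_Suc[OF Suc.prems] by (rule Suc.IH[OF M_mat_mult_vec(1)[OF Suc.prems]])
    finally show ?case .
  }
qed

section \<open>Decay of the coefficients and of the expected objective\<close>

theorem theorem3p4:
  fixes n :: nat and \<delta> :: real and x0 :: "real vec"
    and \<Omega> :: "'w measure" and \<pi> :: "nat \<Rightarrow> 'w \<Rightarrow> nat \<Rightarrow> nat"
  assumes "n \<ge> 10" and "\<delta> \<in> {0..0.4}" and "x0 \<in> carrier_vec n"
    and "prob_space \<Omega>" and "iid_uniform_perms n \<Omega> \<pi>"
  shows "(\<forall>l\<ge>1. \<bar>eta n \<delta> l\<bar> \<le> (1 - 2 * \<delta> + 4 * \<delta>\<^sup>2) ^ (l - 1) * \<delta>
               \<and> \<bar>nu n \<delta> l\<bar> \<le> (1 - 2 * \<delta> + 4 * \<delta>\<^sup>2) ^ (l - 1) * \<delta>)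
       \<and> (\<forall>l\<ge>1. prob_space.expectation \<Omega>
              (\<lambda>\<omega>. quad_obj (A_mat n \<delta>) (cd_iter n (A_mat n \<delta>) (\<lambda>m. \<pi> m \<omega>) x0 (l * n)))
            \<le> 1/2 * (1 - 2 * \<delta> + 4 * \<delta>\<^sup>2) ^ (l - 1)
                 * ((vec_norm2 x0)\<^sup>2 + (ones_vec n \<bullet> x0)\<^sup>2) * \<delta>)"
proof (intro conjI allI impI)
  interpret prob_space \<Omega> by fact
  have \<delta>: "0 \<le> \<delta>" "\<delta> \<le> 2/5" using assms(2) by auto
  fix l :: nat assume l: "l \<ge> 1"
  let ?r = "(1 - 2 * \<delta> + 4 * \<delta>\<^sup>2) ^ (l - 1)"
  show bound: "\<bar>eta n \<delta> l\<bar> \<le> ?r * \<delta>" "\<bar>nu n \<delta> l\<bar> \<le> ?r * \<delta>"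
    by (rule eta_nu_bound[OF assms(1) \<delta> l])+
  let ?x = "\<lambda>\<omega>. cd_iter n (A_mat n \<delta>) (\<lambda>m. \<pi> m \<omega>) x0 (l * n)"
  let ?Q = "\<Sum>i<n. (x0 $ i)\<^sup>2" and ?S = "\<Sum>i<n. x0 $ i"
  \<comment> \<open>For this choice of \<open>v\<close> the vector \<open>M^l v\<close> is
    \<open>eta_nu\<close>, so the expected objective is half its invariant form at
    \<open>x0\<close>.\<close>
  have "vec_of_list [\<delta>, 1 - \<delta>] \<in> carrier_vec 2" by (rule carrier_vecI) simp
  then have "expectation (\<lambda>\<omega>. quad_pair n (vec_of_list [\<delta>, 1 - \<delta>]) (\<lambda>i. ?x \<omega> $ i))
      = quad_pair n (eta_nu n \<delta> l) (\<lambda>i. x0 $ i)"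
    using expectation_quad_pair_cd_iter[OF _ assms(3-5)] assms(1) by (simp add: eta_nu_def)
  then have "expectation (\<lambda>\<omega>. quad_obj (A_mat n \<delta>) (?x \<omega>)) = 1/2 * (eta n \<delta> l * ?Q + nu n \<delta> l * ?S\<^sup>2)"
    unfolding quad_obj_A_mat[OF cd_iter_carrier[OF assms(3)]] by (simp add: quad_pair_def eta_def nu_def)
  also have "\<dots> \<le> 1/2 * (?r * \<delta> * ?Q + ?r * \<delta> * ?S\<^sup>2)"
    using bound by (intro mult_left_mono add_mono mult_right_mono) (auto simp: sum_nonneg)
  also have "?Q = (vec_norm2 x0)\<^sup>2" using assms(3) by (simp add: vec_norm2_square)
  also have "?S = ones_vec n \<bullet> x0"
    using assms(3) by (simp add: ones_vec_def scalar_prod_def atLeast0LessThan)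
  finally show "expectation (\<lambda>\<omega>. quad_obj (A_mat n \<delta>) (?x \<omega>))
      \<le> 1/2 * ?r * ((vec_norm2 x0)\<^sup>2 + (ones_vec n \<bullet> x0)\<^sup>2) * \<delta>"
    by (simp add: algebra_simps)
qed

end
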